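(* Let $\mathcal{C}$ be any quasi-abelian category. Then: (Axiom 1) universal monomorphisms in $\mathcal{C}$ are stable under pullback: if $f\colon A\to B$ is a universal monomorphism in $\mathcal{C}$ and $\delta\colon Z\to B$ is an arbitrary morphism in $\mathcal{C}$, then in the pullback square of $f$ and $\delta$ the morphism $f'\colon A\times_B Z\to Z$ is a universal monomorphism in $\mathcal{C}$; (Axiom 1$^\ast$) universal epimorphisms in $\mathcal{C}$ are stable under pushout: if $f\colon A\to B$ is a universal epimorphism in $\mathcal{C}$ and $g\colon A\to X$ is an arbitrary morphism in $\mathcal{C}$, then in the pushout square of $f$ and $g$ the morphism $f'\colon X\to X\sqcup_A B$ is a universal epimorphism in $\mathcal{C}$.
   Context: An additive category is preabelian if every morphism has a kernel and a cokernel. A preabelian category is quasi-abelian if cokernels (i.e. morphisms that are a cokernel of some morphism) are stable under pullback and kernels (i.e. morphisms that are a kernel of some morphism) are stable under pushout. A class $\mathcal{X}$ of morphisms is stable under pushout if for every $f\colon X\to Y$ in $\mathcal{X}$ and every morphism $g\colon X\to Z$, the morphism $f'\colon Z\to P$ in the pushout square of $f$ and $g$ (with pushout object $P$) lies in $\mathcal{X}$; stability under pullback is defined dually. A universal monomorphism is a monomorphism $f\colon A\to B$ such that for every morphism $g\colon A\to X$ the morphism $f'\colon X\to X\sqcup_A B$ in the pushout square of $f$ and $g$ is a monomorphism. Dually, a universal epimorphism is an epimorphism $f\colon A\to B$ such that for every morphism $\delta\colon Z\to B$ the morphism $A\times_B Z\to Z$ in the pullback square of $f$ and $\delta$ is an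 epimorphism. *)

theory Defs
  imports "HOL-Algebra.Group"
begin

text \<open>
  A category is a record with carrier sets of objects and arrows; composition \<open>g \<cdot> f\<close>
  (first \<open>f\<close>, then \<open>g\<close>) is constrained only on composable pairs. \<open>Add\<close> and \<open>Zero\<close> carry the
  abelian group structure of the hom-sets, \<open>Zero C A B\<close> being the zero arrow from \<open>A\<close> to \<open>B\<close>.
\<close>

record ('o, 'm) cat =
  Obj :: "'o set"
  Arr :: "'m set"
  Dom :: "'m \<Rightarrow> 'o"
  Cod :: "'m \<Rightarrow> 'o"
  Ident :: "'o \<Rightarrow> 'm"
  Comp :: "'m \<Rightarrow> 'm \<Rightarrow> 'm"  (infixr \<open>\<cdot>\<index>\<close> 70)
  Add :: "'m \<Rightarrow> 'm \<Rightarrow> 'm"  (infixl \<open>\<boxplus>\<index>\<close> 65)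
  Zero :: "'o \<Rightarrow> 'o \<Rightarrow> 'm"

definition Homs :: "('o, 'm, 'x) cat_scheme \<Rightarrow> 'o \<Rightarrow> 'o \<Rightarrow> 'm set" where
  "Homs C A B = {f \<in> Arr C. Dom C f = A \<and> Cod C f = B}"

locale category =
  fixes C :: "('o, 'm, 'x) cat_scheme" (structure)
  assumes Dom_in_Obj: "f \<in> Arr C \<Longrightarrow> Dom C f \<in> Obj C"
    and Cod_in_Obj: "f \<in> Arr C \<Longrightarrow> Cod C f \<in> Obj C"
    and Ident_in_Homs: "A \<in> Obj C \<Longrightarrow> Ident C A \<in> Homs C A A"
    and Comp_in_Homs: "f \<in> Homs C A B \<Longrightarrow> g \<in> Homs C B D \<Longrightarrow> g \<cdot> f \<in> Homs C A D"
    and Comp_Ident_right: "f \<in> Homs C A B \<Longrightarrow> f \<cdot> Ident C A = f"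
    and Comp_Ident_left: "f \<in> Homs C A B \<Longrightarrow> Ident C B \<cdot> f = f"
    and Comp_assoc: "f \<in> Homs C A B \<Longrightarrow> g \<in> Homs C B D \<Longrightarrow> h \<in> Homs C D E \<Longrightarrow>
      (h \<cdot> g) \<cdot> f = h \<cdot> (g \<cdot> f)"

definition Hom_group :: "('o, 'm, 'x) cat_scheme \<Rightarrow> 'o \<Rightarrow> 'o \<Rightarrow> 'm monoid" where
  "Hom_group C A B = \<lparr>carrier = Homs C A B, monoid.mult = Add C, one = Zero C A B\<rparr>"

locale preadditive_category = category +
  assumes Hom_comm_group: "A \<in> Obj C \<Longrightarrow> B \<in> Obj C \<Longrightarrow> comm_group (Hom_group C A B)"
    and Comp_Add_right: "f \<in> Homs C A B \<Longrightarrow> f' \<in> Homs C A B \<Longrightarrow> g \<in> Homs C B D \<Longrightarrow>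
      g \<cdot> (f \<boxplus> f') = (g \<cdot> f) \<boxplus> (g \<cdot> f')"
    and Comp_Add_left: "f \<in> Homs C A B \<Longrightarrow> g \<in> Homs C B D \<Longrightarrow> g' \<in> Homs C B D \<Longrightarrow>
      (g \<boxplus> g') \<cdot> f = (g \<cdot> f) \<boxplus> (g' \<cdot> f)"

definition zero_object :: "('o, 'm, 'x) cat_scheme \<Rightarrow> 'o \<Rightarrow> bool" where
  "zero_object C Z \<longleftrightarrow> Z \<in> Obj C \<and>
     (\<forall>A \<in> Obj C. (\<exists>!f. f \<in> Homs C Z A) \<and> (\<exists>!f. f \<in> Homs C A Z))"

definition biproduct ::
  "('o, 'm, 'x) cat_scheme \<Rightarrow> 'o \<Rightarrow> 'o \<Rightarrow> 'o \<Rightarrow> 'm \<Rightarrow> 'm \<Rightarrow> 'm \<Rightarrow> 'm \<Rightarrow> bool" where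
  "biproduct C A B S i j p q \<longleftrightarrow>
     i \<in> Homs C A S \<and> j \<in> Homs C B S \<and> p \<in> Homs C S A \<and> q \<in> Homs C S B \<and>
     p \<cdot>\<^bsub>C\<^esub> i = Ident C A \<and> q \<cdot>\<^bsub>C\<^esub> j = Ident C B \<and>
     p \<cdot>\<^bsub>C\<^esub> j = Zero C B A \<and> q \<cdot>\<^bsub>C\<^esub> i = Zero C A B \<and>
     (i \<cdot>\<^bsub>C\<^esub> p) \<boxplus>\<^bsub>C\<^esub> (j \<cdot>\<^bsub>C\<^esub> q) = Ident C S"

locale additive_category = preadditive_category +
  assumes ex_zero_object: "\<exists>Z. zero_object C Z"
    and ex_biproduct: "A \<in> Obj C \<Longrightarrow> B \<in> Obj C \<Longrightarrow> \<exists>S i j p q. biproduct C A B S i j p q"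

definition kernel_of :: "('o, 'm, 'x) cat_scheme \<Rightarrow> 'm \<Rightarrow> 'm \<Rightarrow> bool" where
  "kernel_of C f k \<longleftrightarrow> f \<in> Arr C \<and> k \<in> Arr C \<and> Cod C k = Dom C f \<and>
     f \<cdot>\<^bsub>C\<^esub> k = Zero C (Dom C k) (Cod C f) \<and>
     (\<forall>h \<in> Arr C. Cod C h = Dom C f \<and> f \<cdot>\<^bsub>C\<^esub> h = Zero C (Dom C h) (Cod C f) \<longrightarrow>
        (\<exists>!u. u \<in> Homs C (Dom C h) (Dom C k) \<and> k \<cdot>\<^bsub>C\<^esub> u = h))"

definition cokernel_of :: "('o, 'm, 'x) cat_scheme \<Rightarrow> 'm \<Rightarrow> 'm \<Rightarrow> bool" where
  "cokernel_of C f c \<longleftrightarrow> f \<in> Arr C \<and> c \<in> Arr C \<and> Dom C c = Cod C f \<and>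
     c \<cdot>\<^bsub>C\<^esub> f = Zero C (Dom C f) (Cod C c) \<and>
     (\<forall>h \<in> Arr C. Dom C h = Cod C f \<and> h \<cdot>\<^bsub>C\<^esub> f = Zero C (Dom C f) (Cod C h) \<longrightarrow>
        (\<exists>!u. u \<in> Homs C (Cod C c) (Cod C h) \<and> u \<cdot>\<^bsub>C\<^esub> c = h))"

definition is_kernel :: "('o, 'm, 'x) cat_scheme \<Rightarrow> 'm \<Rightarrow> bool" where
  "is_kernel C k \<longleftrightarrow> (\<exists>f. kernel_of C f k)"

definition is_cokernel :: "('o, 'm, 'x) cat_scheme \<Rightarrow> 'm \<Rightarrow> bool" where
  "is_cokernel C c \<longleftrightarrow> (\<exists>f. cokernel_of C f c)"

locale preabelian_category = additive_category +
  assumes ex_kernel: "f \<in> Arr C \<Longrightarrow> \<exists>k. kernel_of C f k"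
    and ex_cokernel: "f \<in> Arr C \<Longrightarrow> \<exists>c. cokernel_of C f c"

text \<open>
  In both squares the primed arrow is the one opposite to (parallel to) its unprimed namesake:
  a pushout of \<open>f: A \<rightarrow> B\<close> and \<open>g: A \<rightarrow> X\<close> has \<open>f': X \<rightarrow> P\<close> and \<open>g': B \<rightarrow> P\<close>;
  a pullback of \<open>f: A \<rightarrow> B\<close> and \<open>d: Z \<rightarrow> B\<close> has \<open>f': P \<rightarrow> Z\<close> and \<open>d': P \<rightarrow> A\<close>.
\<close>

definition pushout_square ::
  "('o, 'm, 'x) cat_scheme \<Rightarrow> 'm \<Rightarrow> 'm \<Rightarrow> 'm \<Rightarrow> 'm \<Rightarrow> bool" where
  "pushout_square C f g f' g' \<longleftrightarrow>
     f \<in> Arr C \<and> g \<in> Arr C \<and> f' \<in> Arr C \<and> g' \<in> Arr C \<and>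
     Dom C f = Dom C g \<and> Dom C f' = Cod C g \<and> Dom C g' = Cod C f \<and> Cod C f' = Cod C g' \<and>
     f' \<cdot>\<^bsub>C\<^esub> g = g' \<cdot>\<^bsub>C\<^esub> f \<and>
     (\<forall>T. \<forall>s \<in> Homs C (Cod C g) T. \<forall>t \<in> Homs C (Cod C f) T. s \<cdot>\<^bsub>C\<^esub> g = t \<cdot>\<^bsub>C\<^esub> f \<longrightarrow>
        (\<exists>!u. u \<in> Homs C (Cod C f') T \<and> u \<cdot>\<^bsub>C\<^esub> f' = s \<and> u \<cdot>\<^bsub>C\<^esub> g' = t))"

definition pullback_square ::
  "('o, 'm, 'x) cat_scheme \<Rightarrow> 'm \<Rightarrow> 'm \<Rightarrow> 'm \<Rightarrow> 'm \<Rightarrow> bool" where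
  "pullback_square C f d f' d' \<longleftrightarrow>
     f \<in> Arr C \<and> d \<in> Arr C \<and> f' \<in> Arr C \<and> d' \<in> Arr C \<and>
     Cod C f = Cod C d \<and> Cod C f' = Dom C d \<and> Cod C d' = Dom C f \<and> Dom C f' = Dom C d' \<and>
     d \<cdot>\<^bsub>C\<^esub> f' = f \<cdot>\<^bsub>C\<^esub> d' \<and>
     (\<forall>T. \<forall>s \<in> Homs C T (Dom C d). \<forall>t \<in> Homs C T (Dom C f). d \<cdot>\<^bsub>C\<^esub> s = f \<cdot>\<^bsub>C\<^esub> t \<longrightarrow>
        (\<exists>!u. u \<in> Homs C T (Dom C f') \<and> f' \<cdot>\<^bsub>C\<^esub> u = s \<and> d' \<cdot>\<^bsub>C\<^esub> u = t))"

definition stable_under_pushout ::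
  "('o, 'm, 'x) cat_scheme \<Rightarrow> ('m \<Rightarrow> bool) \<Rightarrow> bool" where
  "stable_under_pushout C X \<longleftrightarrow>
     (\<forall>f g f' g'. X f \<and> pushout_square C f g f' g' \<longrightarrow> X f')"

definition stable_under_pullback ::
  "('o, 'm, 'x) cat_scheme \<Rightarrow> ('m \<Rightarrow> bool) \<Rightarrow> bool" where
  "stable_under_pullback C X \<longleftrightarrow>
     (\<forall>f d f' d'. X f \<and> pullback_square C f d f' d' \<longrightarrow> X f')"

locale quasi_abelian_category = preabelian_category +
  assumes cokernels_stable: "stable_under_pullback C (is_cokernel C)"
    and kernels_stable: "stable_under_pushout C (is_kernel C)"

definition monomorphism :: "('o, 'm, 'x) cat_scheme \<Rightarrow> 'm \<Rightarrow> bool" where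
  "monomorphism C f \<longleftrightarrow> f \<in> Arr C \<and>
     (\<forall>T. \<forall>s \<in> Homs C T (Dom C f). \<forall>t \<in> Homs C T (Dom C f).
        f \<cdot>\<^bsub>C\<^esub> s = f \<cdot>\<^bsub>C\<^esub> t \<longrightarrow> s = t)"

definition epimorphism :: "('o, 'm, 'x) cat_scheme \<Rightarrow> 'm \<Rightarrow> bool" where
  "epimorphism C f \<longleftrightarrow> f \<in> Arr C \<and>
     (\<forall>T. \<forall>s \<in> Homs C (Cod C f) T. \<forall>t \<in> Homs C (Cod C f) T.
        s \<cdot>\<^bsub>C\<^esub> f = t \<cdot>\<^bsub>C\<^esub> f \<longrightarrow> s = t)"

definition universal_mono :: "('o, 'm, 'x) cat_scheme \<Rightarrow> 'm \<Rightarrow> bool" where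
  "universal_mono C f \<longleftrightarrow> monomorphism C f \<and>
     (\<forall>g f' g'. pushout_square C f g f' g' \<longrightarrow> monomorphism C f')"

definition universal_epi :: "('o, 'm, 'x) cat_scheme \<Rightarrow> 'm \<Rightarrow> bool" where
  "universal_epi C f \<longleftrightarrow> epimorphism C f \<and>
     (\<forall>d f' d'. pullback_square C f d f' d' \<longrightarrow> epimorphism C f')"

text \<open>
  Stability quantifies over all pushout (pullback) squares of the given arrows. Such squares
  always exist in a preabelian category, so the quantification is never vacuous.
\<close>

context preadditive_category
begin

lemma HomsD: "f \<in> Homs C A B \<Longrightarrow> f \<in> Arr C \<and> Dom C f = A \<and> Cod C f = B \<and> A \<in> Obj C \<and> B \<in> Obj C"
  using Dom_in_Obj Cod_in_Obj by (auto simp: Homs_def)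

lemma Add_in_Homs: "f \<in> Homs C A B \<Longrightarrow> g \<in> Homs C A B \<Longrightarrow> f \<boxplus> g \<in> Homs C A B"
  using monoid.m_closed[OF group.axioms(1)[OF comm_group.axioms(2)[OF Hom_comm_group[of A B]]], of f g] HomsD[of f A B]
  by (simp add: Hom_group_def)

lemma Zero_in_Homs: "A \<in> Obj C \<Longrightarrow> B \<in> Obj C \<Longrightarrow> Zero C A B \<in> Homs C A B"
  using monoid.one_closed[OF group.axioms(1)[OF comm_group.axioms(2)[OF Hom_comm_group[of A B]]]]
  by (simp add: Hom_group_def)

lemma Add_Zero_right: "f \<in> Homs C A B \<Longrightarrow> f \<boxplus> Zero C A B = f"
  using monoid.r_one[OF group.axioms(1)[OF comm_group.axioms(2)[OF Hom_comm_group[of A B]]], of f] HomsD[of f A B]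
  by (simp add: Hom_group_def)

lemma Add_Zero_left: "f \<in> Homs C A B \<Longrightarrow> Zero C A B \<boxplus> f = f"
  using monoid.l_one[OF group.axioms(1)[OF comm_group.axioms(2)[OF Hom_comm_group[of A B]]], of f] HomsD[of f A B]
  by (simp add: Hom_group_def)

lemma Add_cancel_right:
  "f \<in> Homs C A B \<Longrightarrow> g \<in> Homs C A B \<Longrightarrow> h \<in> Homs C A B \<Longrightarrow> f \<boxplus> h = g \<boxplus> h \<longleftrightarrow> f = g"
  using group.right_cancel[OF comm_group.axioms(2)[OF Hom_comm_group[of A B]], of h f g] HomsD[of f A B]
  by (simp add: Hom_group_def)

lemma ex_Add_inverse: "f \<in> Homs C A B \<Longrightarrow> \<exists>n \<in> Homs C A B. n \<boxplus> f = Zero C A B"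
  using group.l_inv_ex[OF comm_group.axioms(2)[OF Hom_comm_group[of A B]], of f] HomsD[of f A B]
  by (simp add: Hom_group_def)

lemma Comp_Zero_right:
  assumes "A \<in> Obj C" "f \<in> Homs C B D" shows "f \<cdot> Zero C A B = Zero C A D"
proof -
  have B: "B \<in> Obj C" and D: "D \<in> Obj C" using assms(2) HomsD by blast+
  note z = Zero_in_Homs[OF assms(1) B]
  note c = Comp_in_Homs[OF z assms(2)]
  have "f \<cdot> Zero C A B \<boxplus> f \<cdot> Zero C A B = f \<cdot> Zero C A B"
    using Comp_Add_right[OF z z assms(2)] Add_Zero_right[OF z] by simp
  then show ?thesis
    using Add_cancel_right[OF c Zero_in_Homs[OF assms(1) D] c] Add_Zero_left[OF c] by simp
qed

lemma Comp_Zero_left: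
  assumes "D \<in> Obj C" "f \<in> Homs C A B" shows "Zero C B D \<cdot> f = Zero C A D"
proof -
  have A: "A \<in> Obj C" and B: "B \<in> Obj C" using assms(2) HomsD by blast+
  note z = Zero_in_Homs[OF B assms(1)]
  note c = Comp_in_Homs[OF assms(2) z]
  have "Zero C B D \<cdot> f \<boxplus> Zero C B D \<cdot> f = Zero C B D \<cdot> f"
    using Comp_Add_left[OF assms(2) z z] Add_Zero_right[OF z] by simp
  then show ?thesis
    using Add_cancel_right[OF c Zero_in_Homs[OF A assms(1)] c] Add_Zero_left[OF c] by simp
qed

end

context preabelian_category
begin

lemma ex_pullback_square:
  assumes f: "f \<in> Homs C A B" and d: "d \<in> Homs C Z B"
  shows "\<exists>f' d'. pullback_square C f d f' d'"
proof -
  have ob: "A \<in> Obj C" "B \<in> Obj C" "Z \<in> Obj C" using f d HomsD by blast+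
  obtain S i j p q where "biproduct C A Z S i j p q" using ex_biproduct[OF ob(1,3)] by blast
  then have i: "i \<in> Homs C A S" and j: "j \<in> Homs C Z S" and p: "p \<in> Homs C S A" and q: "q \<in> Homs C S Z"
    and pi: "p \<cdot> i = Ident C A" and qj: "q \<cdot> j = Ident C Z" and pj: "p \<cdot> j = Zero C Z A"
    and qi: "q \<cdot> i = Zero C A Z" and sp: "i \<cdot> p \<boxplus> j \<cdot> q = Ident C S"
    by (auto simp: biproduct_def)
  note fp = Comp_in_Homs[OF p f] and dq = Comp_in_Homs[OF q d]
  obtain n where n: "n \<in> Homs C S B" and nz: "n \<boxplus> d \<cdot> q = Zero C S B"
    using ex_Add_inverse[OF dq] by blast
  define w where "w = f \<cdot> p \<boxplus> n"
  have w: "w \<in> Homs C S B" unfolding w_def by (rule Add_in_Homs[OF fp n])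
  have key: "w \<cdot> h = Zero C T B \<longleftrightarrow> d \<cdot> (q \<cdot> h) = f \<cdot> (p \<cdot> h)" if h: "h \<in> Homs C T S" for h T
  proof -
    have T: "T \<in> Obj C" using h HomsD by blast
    note nh = Comp_in_Homs[OF h n] and dqh = Comp_in_Homs[OF h dq] and fph = Comp_in_Homs[OF h fp]
    note zz = Zero_in_Homs[OF T ob(2)]
    have e1: "w \<cdot> h = (f \<cdot> p) \<cdot> h \<boxplus> n \<cdot> h" unfolding w_def by (rule Comp_Add_left[OF h fp n])
    have e2: "n \<cdot> h \<boxplus> (d \<cdot> q) \<cdot> h = Zero C T B"
      using Comp_Add_left[OF h n dq] nz Comp_Zero_left[OF ob(2) h] by simp
    interpret G: comm_group "Hom_group C T B" by (rule Hom_comm_group[OF T ob(2)])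
    have "n \<cdot> h \<boxplus> (d \<cdot> q) \<cdot> h = (d \<cdot> q) \<cdot> h \<boxplus> n \<cdot> h"
      using G.m_comm[of "n \<cdot> h" "(d \<cdot> q) \<cdot> h"] nh dqh by (simp add: Hom_group_def)
    then have "w \<cdot> h = Zero C T B \<longleftrightarrow> (f \<cdot> p) \<cdot> h \<boxplus> n \<cdot> h = (d \<cdot> q) \<cdot> h \<boxplus> n \<cdot> h"
      using e1 e2 by simp
    also have "\<dots> \<longleftrightarrow> (f \<cdot> p) \<cdot> h = (d \<cdot> q) \<cdot> h" by (rule Add_cancel_right[OF fph dqh nh])
    finally show ?thesis using Comp_assoc[OF h p f] Comp_assoc[OF h q d] by (metis (no_types))
  qed
  obtain k where kk: "kernel_of C w k" using ex_kernel HomsD[OF w] by blast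
  define P where "P = Dom C k"
  have k: "k \<in> Homs C P S" and wk: "w \<cdot> k = Zero C P B"
    using kk HomsD[OF w] unfolding kernel_of_def Homs_def P_def by simp_all
  have ku: "\<exists>!u. u \<in> Homs C T P \<and> k \<cdot> u = h" if "h \<in> Homs C T S" "w \<cdot> h = Zero C T B" for h T
  proof -
    have "\<forall>h \<in> Arr C. Cod C h = Dom C w \<and> w \<cdot> h = Zero C (Dom C h) (Cod C w) \<longrightarrow>
        (\<exists>!u. u \<in> Homs C (Dom C h) P \<and> k \<cdot> u = h)"
      using kk unfolding kernel_of_def P_def by blast
    from bspec[OF this, of h] show ?thesis using that(2) HomsD[OF w] HomsD[OF that(1)] by simp
  qed
  note qk = Comp_in_Homs[OF k q] and pk = Comp_in_Homs[OF k p]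
  have univ: "\<exists>!u. u \<in> Homs C T P \<and> (q \<cdot> k) \<cdot> u = s \<and> (p \<cdot> k) \<cdot> u = t"
    if s: "s \<in> Homs C T Z" and t: "t \<in> Homs C T A" and st: "d \<cdot> s = f \<cdot> t" for T s t
  proof -
    have T: "T \<in> Obj C" using s HomsD by blast
    note it = Comp_in_Homs[OF t i] and js = Comp_in_Homs[OF s j]
    define h where "h = i \<cdot> t \<boxplus> j \<cdot> s"
    have h: "h \<in> Homs C T S" unfolding h_def by (rule Add_in_Homs[OF it js])
    have ph: "p \<cdot> h = t" unfolding h_def
      using Comp_Add_right[OF it js p] Comp_assoc[OF t i p] Comp_assoc[OF s j p] pi pj
        Comp_Ident_left[OF t] Comp_Zero_left[OF ob(1) s] Add_Zero_right[OF t] by simp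
    have qh: "q \<cdot> h = s" unfolding h_def
      using Comp_Add_right[OF it js q] Comp_assoc[OF t i q] Comp_assoc[OF s j q] qi qj
        Comp_Ident_left[OF s] Comp_Zero_left[OF ob(3) t] Add_Zero_left[OF s] by simp
    have eq: "(q \<cdot> k) \<cdot> u = s \<and> (p \<cdot> k) \<cdot> u = t \<longleftrightarrow> k \<cdot> u = h" if u: "u \<in> Homs C T P" for u
    proof -
      note kku = Comp_in_Homs[OF u k]
      have "k \<cdot> u = (i \<cdot> p \<boxplus> j \<cdot> q) \<cdot> (k \<cdot> u)" using sp Comp_Ident_left[OF kku] by simp
      also have "\<dots> = i \<cdot> (p \<cdot> (k \<cdot> u)) \<boxplus> j \<cdot> (q \<cdot> (k \<cdot> u))"
        using Comp_Add_left[OF kku Comp_in_Homs[OF p i] Comp_in_Homs[OF q j]]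
          Comp_assoc[OF kku p i] Comp_assoc[OF kku q j] by simp
      finally have "k \<cdot> u = i \<cdot> (p \<cdot> (k \<cdot> u)) \<boxplus> j \<cdot> (q \<cdot> (k \<cdot> u))" .
      then show ?thesis
        using Comp_assoc[OF u k p] Comp_assoc[OF u k q] ph qh by (auto simp: h_def)
    qed
    have "w \<cdot> h = Zero C T B" using key[OF h] ph qh st by simp
    from ku[OF h this] have "\<exists>!u. u \<in> Homs C T P \<and> k \<cdot> u = h" .
    moreover have "(u \<in> Homs C T P \<and> (q \<cdot> k) \<cdot> u = s \<and> (p \<cdot> k) \<cdot> u = t) = (u \<in> Homs C T P \<and> k \<cdot> u = h)" for u
      using eq by blast
    ultimately show ?thesis by simp
  qed
  have "d \<cdot> (q \<cdot> k) = f \<cdot> (p \<cdot> k)" using key[OF k] wk by simp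
  then have "pullback_square C f d (q \<cdot> k) (p \<cdot> k)"
    unfolding pullback_square_def
    using univ HomsD[OF qk] HomsD[OF pk] HomsD[OF f] HomsD[OF d] by simp
  then show ?thesis by blast
qed

lemma ex_pushout_square:
  assumes f: "f \<in> Homs C A B" and g: "g \<in> Homs C A X"
  shows "\<exists>f' g'. pushout_square C f g f' g'"
proof -
  have ob: "A \<in> Obj C" "B \<in> Obj C" "X \<in> Obj C" using f g HomsD by blast+
  obtain S i j p q where "biproduct C B X S i j p q" using ex_biproduct[OF ob(2,3)] by blast
  then have i: "i \<in> Homs C B S" and j: "j \<in> Homs C X S" and p: "p \<in> Homs C S B" and q: "q \<in> Homs C S X"
    and pi: "p \<cdot> i = Ident C B" and qj: "q \<cdot> j = Ident C X" and pj: "p \<cdot> j = Zero C X B"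
    and qi: "q \<cdot> i = Zero C B X" and sp: "i \<cdot> p \<boxplus> j \<cdot> q = Ident C S"
    by (auto simp: biproduct_def)
  note fi = Comp_in_Homs[OF f i] and gj = Comp_in_Homs[OF g j]
  obtain n where n: "n \<in> Homs C A S" and nz: "n \<boxplus> j \<cdot> g = Zero C A S"
    using ex_Add_inverse[OF gj] by blast
  define w where "w = i \<cdot> f \<boxplus> n"
  have w: "w \<in> Homs C A S" unfolding w_def by (rule Add_in_Homs[OF fi n])
  have key: "h \<cdot> w = Zero C A T \<longleftrightarrow> (h \<cdot> j) \<cdot> g = (h \<cdot> i) \<cdot> f" if h: "h \<in> Homs C S T" for h T
  proof -
    have T: "T \<in> Obj C" using h HomsD by blast
    note nh = Comp_in_Homs[OF n h] and gjh = Comp_in_Homs[OF gj h] and fih = Comp_in_Homs[OF fi h]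
    have e1: "h \<cdot> w = h \<cdot> (i \<cdot> f) \<boxplus> h \<cdot> n" unfolding w_def by (rule Comp_Add_right[OF fi n h])
    have e2: "h \<cdot> n \<boxplus> h \<cdot> (j \<cdot> g) = Zero C A T"
      using Comp_Add_right[OF n gj h] nz Comp_Zero_right[OF ob(1) h] by simp
    interpret G: comm_group "Hom_group C A T" by (rule Hom_comm_group[OF ob(1) T])
    have "h \<cdot> n \<boxplus> h \<cdot> (j \<cdot> g) = h \<cdot> (j \<cdot> g) \<boxplus> h \<cdot> n"
      using G.m_comm[of "h \<cdot> n" "h \<cdot> (j \<cdot> g)"] nh gjh by (simp add: Hom_group_def)
    then have "h \<cdot> w = Zero C A T \<longleftrightarrow> h \<cdot> (i \<cdot> f) \<boxplus> h \<cdot> n = h \<cdot> (j \<cdot> g) \<boxplus> h \<cdot> n"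
      using e1 e2 by simp
    also have "\<dots> \<longleftrightarrow> h \<cdot> (i \<cdot> f) = h \<cdot> (j \<cdot> g)" by (rule Add_cancel_right[OF fih gjh nh])
    finally show ?thesis using Comp_assoc[OF f i h] Comp_assoc[OF g j h] by (metis (no_types))
  qed
  obtain c where cc: "cokernel_of C w c" using ex_cokernel HomsD[OF w] by blast
  define P where "P = Cod C c"
  have c: "c \<in> Homs C S P" and wc: "c \<cdot> w = Zero C A P"
    using cc HomsD[OF w] unfolding cokernel_of_def Homs_def P_def by simp_all
  have cu: "\<exists>!u. u \<in> Homs C P T \<and> u \<cdot> c = h" if "h \<in> Homs C S T" "h \<cdot> w = Zero C A T" for h T
  proof -
    have "\<forall>h \<in> Arr C. Dom C h = Cod C w \<and> h \<cdot> w = Zero C (Dom C w) (Cod C h) \<longrightarrow>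
        (\<exists>!u. u \<in> Homs C P (Cod C h) \<and> u \<cdot> c = h)"
      using cc unfolding cokernel_of_def P_def by blast
    from bspec[OF this, of h] show ?thesis using that(2) HomsD[OF w] HomsD[OF that(1)] by simp
  qed
  note cj = Comp_in_Homs[OF j c] and ci = Comp_in_Homs[OF i c]
  have univ: "\<exists>!u. u \<in> Homs C P T \<and> u \<cdot> (c \<cdot> j) = s \<and> u \<cdot> (c \<cdot> i) = t"
    if s: "s \<in> Homs C X T" and t: "t \<in> Homs C B T" and st: "s \<cdot> g = t \<cdot> f" for T s t
  proof -
    have T: "T \<in> Obj C" using s HomsD by blast
    note tp = Comp_in_Homs[OF p t] and sq = Comp_in_Homs[OF q s]
    define h where "h = t \<cdot> p \<boxplus> s \<cdot> q"
    have h: "h \<in> Homs C S T" unfolding h_def by (rule Add_in_Homs[OF tp sq])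
    have hi: "h \<cdot> i = t" unfolding h_def
      using Comp_Add_left[OF i tp sq] Comp_assoc[OF i p t] Comp_assoc[OF i q s] pi qi
        Comp_Ident_right[OF t] Comp_Zero_right[OF ob(2) s] Add_Zero_right[OF t] by simp
    have hj: "h \<cdot> j = s" unfolding h_def
      using Comp_Add_left[OF j tp sq] Comp_assoc[OF j p t] Comp_assoc[OF j q s] pj qj
        Comp_Ident_right[OF s] Comp_Zero_right[OF ob(3) t] Add_Zero_left[OF s] by simp
    have eq: "u \<cdot> (c \<cdot> j) = s \<and> u \<cdot> (c \<cdot> i) = t \<longleftrightarrow> u \<cdot> c = h" if u: "u \<in> Homs C P T" for u
    proof -
      note uc = Comp_in_Homs[OF c u]
      have "u \<cdot> c = (u \<cdot> c) \<cdot> (i \<cdot> p \<boxplus> j \<cdot> q)" using sp Comp_Ident_right[OF uc] by simp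
      also have "\<dots> = ((u \<cdot> c) \<cdot> i) \<cdot> p \<boxplus> ((u \<cdot> c) \<cdot> j) \<cdot> q"
        using Comp_Add_right[OF Comp_in_Homs[OF p i] Comp_in_Homs[OF q j] uc]
          Comp_assoc[OF p i uc] Comp_assoc[OF q j uc] by simp
      finally have "u \<cdot> c = ((u \<cdot> c) \<cdot> i) \<cdot> p \<boxplus> ((u \<cdot> c) \<cdot> j) \<cdot> q" .
      then show ?thesis
        using Comp_assoc[OF i c u] Comp_assoc[OF j c u] hi hj by (auto simp: h_def)
    qed
    have "h \<cdot> w = Zero C A T" using key[OF h] hi hj st by simp
    from cu[OF h this] have "\<exists>!u. u \<in> Homs C P T \<and> u \<cdot> c = h" .
    moreover have "(u \<in> Homs C P T \<and> u \<cdot> (c \<cdot> j) = s \<and> u \<cdot> (c \<cdot> i) = t) = (u \<in> Homs C P T \<and> u \<cdot> c = h)" for u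
      using eq by blast
    ultimately show ?thesis by simp
  qed
  have "(c \<cdot> j) \<cdot> g = (c \<cdot> i) \<cdot> f" using key[OF c] wc by simp
  then have "pushout_square C f g (c \<cdot> j) (c \<cdot> i)"
    unfolding pushout_square_def
    using univ HomsD[OF cj] HomsD[OF ci] HomsD[OF f] HomsD[OF g] by simp
  then show ?thesis by blast
qed

end

end

theory Submission
  imports Defs
begin

text \<open>
  The opposite of a quasi-abelian category is quasi-abelian, and passing to it exchanges the two
  halves of the theorem, so it is enough to treat universal monomorphisms.

  Let \<open>f: A \<rightarrow> B\<close> be a universal monomorphism with pullback \<open>f': P \<rightarrow> Z\<close> along \<open>d: Z \<rightarrow> B\<close>, and
  write \<open>d': P \<rightarrow> A\<close> for the remaining side. The difficulty is that the universality of \<open>f\<close> speaks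
  about arrows out of \<open>A\<close>, while \<open>f'\<close> has to be pushed out along an arbitrary \<open>g: P \<rightarrow> X\<close>, which
  need not extend along \<open>d'\<close>. However, the pair \<open>k = (d', f'): P \<rightarrow> A \<oplus> Z\<close> is a kernel, namely of
  the difference of the two composites \<open>A \<oplus> Z \<rightarrow> B\<close> through \<open>f\<close> and \<open>d\<close>
  (\<open>pullback_pair_is_kernel\<close>). Hence the pushout \<open>k': X \<rightarrow> Y\<close> of \<open>k\<close> along \<open>g\<close> is again a kernel,
  in particular a monomorphism. At the cost of enlarging \<open>X\<close> to \<open>Y\<close>, the arrow \<open>g\<close> is thus extended
  to \<open>(a, b): A \<oplus> Z \<rightarrow> Y\<close>, that is, \<open>k' \<cdot> g = a \<cdot> d' + b \<cdot> f'\<close>.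

  Since \<open>f\<close> is universal, its pushout \<open>F: Y \<rightarrow> Q\<close> along \<open>a\<close> is a monomorphism; let
  \<open>a': B \<rightarrow> Q\<close> be the other side, so \<open>F \<cdot> a = a' \<cdot> f\<close>. Then \<open>F \<cdot> k' \<cdot> g = (a' \<cdot> d + F \<cdot> b) \<cdot> f'\<close>,
  so the monomorphism \<open>F \<cdot> k': X \<rightarrow> Q\<close> factors through the pushout \<open>X \<rightarrow> X \<squnion>\<^sub>P Z\<close> of \<open>f'\<close>. A first
  factor of a monomorphism is a monomorphism, which is what was to be shown.
\<close>

section \<open>Monomorphisms and kernels\<close>

context preadditive_category
begin

lemma monomorphismD:
  assumes "monomorphism C f" "f \<in> Homs C A B" "s \<in> Homs C T A" "t \<in> Homs C T A" "f \<cdot> s = f \<cdot> t"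
  shows "s = t"
  using assms unfolding monomorphism_def Homs_def by blast

lemma monomorphismI:
  assumes "f \<in> Homs C A B"
    and "\<And>T s t. s \<in> Homs C T A \<Longrightarrow> t \<in> Homs C T A \<Longrightarrow> f \<cdot> s = f \<cdot> t \<Longrightarrow> s = t"
  shows "monomorphism C f"
  using assms unfolding monomorphism_def Homs_def by blast

lemma monomorphism_Comp:
  assumes f: "f \<in> Homs C A B" and g: "g \<in> Homs C B D"
    and mf: "monomorphism C f" and mg: "monomorphism C g"
  shows "monomorphism C (g \<cdot> f)"
proof (rule monomorphismI[OF Comp_in_Homs[OF f g]])
  fix T s t assume s: "s \<in> Homs C T A" and t: "t \<in> Homs C T A" and eq: "(g \<cdot> f) \<cdot> s = (g \<cdot> f) \<cdot> t"
  have "g \<cdot> (f \<cdot> s) = g \<cdot> (f \<cdot> t)" using eq Comp_assoc[OF s f g] Comp_assoc[OF t f g] by simp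
  then have "f \<cdot> s = f \<cdot> t" using monomorphismD[OF mg g Comp_in_Homs[OF s f] Comp_in_Homs[OF t f]] by simp
  then show "s = t" using monomorphismD[OF mf f s t] by simp
qed

lemma monomorphism_first_factor:
  assumes f: "f \<in> Homs C A B" and u: "u \<in> Homs C B D" and m: "monomorphism C (u \<cdot> f)"
  shows "monomorphism C f"
proof (rule monomorphismI[OF f])
  fix T s t assume s: "s \<in> Homs C T A" and t: "t \<in> Homs C T A" and eq: "f \<cdot> s = f \<cdot> t"
  have "(u \<cdot> f) \<cdot> s = (u \<cdot> f) \<cdot> t" using eq Comp_assoc[OF s f u] Comp_assoc[OF t f u] by simp
  then show "s = t" using monomorphismD[OF m Comp_in_Homs[OF f u] s t] by simp
qed

lemma kernel_is_monomorphism: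
  assumes "is_kernel C k"
  shows "monomorphism C k"
proof -
  obtain w where w: "kernel_of C w k" using assms by (auto simp: is_kernel_def)
  define P where "P = Dom C k"
  define S where "S = Dom C w"
  define B where "B = Cod C w"
  have k: "k \<in> Homs C P S" and wh: "w \<in> Homs C S B" and wk: "w \<cdot> k = Zero C P B"
    using w unfolding kernel_of_def Homs_def P_def S_def B_def by simp_all
  have B: "B \<in> Obj C" using HomsD[OF wh] by simp
  show ?thesis
  proof (rule monomorphismI[OF k])
    fix T s t assume s: "s \<in> Homs C T P" and t: "t \<in> Homs C T P" and eq: "k \<cdot> s = k \<cdot> t"
    have ks: "k \<cdot> s \<in> Homs C T S" by (rule Comp_in_Homs[OF s k])
    have "w \<cdot> (k \<cdot> s) = Zero C T B" using Comp_assoc[OF s k wh] wk Comp_Zero_left[OF B s] by simp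
    moreover have univ: "\<forall>h \<in> Arr C. Cod C h = S \<and> w \<cdot> h = Zero C (Dom C h) B \<longrightarrow>
        (\<exists>!u. u \<in> Homs C (Dom C h) P \<and> k \<cdot> u = h)"
      using w unfolding kernel_of_def P_def S_def B_def by blast
    ultimately have "\<exists>!u. u \<in> Homs C T P \<and> k \<cdot> u = k \<cdot> s"
      using bspec[OF univ, of "k \<cdot> s"] HomsD[OF ks] by simp
    then show "s = t" using s t eq by auto
  qed
qed

text \<open>
  Subtraction of arrows, expressed by the one property that matters here: the arrows annihilated by
  \<open>f - g\<close> are those that equalize \<open>f\<close> and \<open>g\<close>.
\<close>

lemma ex_difference:
  assumes f: "f \<in> Homs C A B" and g: "g \<in> Homs C A B"
  shows "\<exists>w \<in> Homs C A B. \<forall>T. \<forall>h \<in> Homs C T A. w \<cdot> h = Zero C T B \<longleftrightarrow> f \<cdot> h = g \<cdot> h"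
proof -
  obtain n where n: "n \<in> Homs C A B" and ng: "n \<boxplus> g = Zero C A B" using ex_Add_inverse[OF g] by blast
  have "(f \<boxplus> n) \<cdot> h = Zero C T B \<longleftrightarrow> f \<cdot> h = g \<cdot> h" if h: "h \<in> Homs C T A" for T h
  proof -
    have T: "T \<in> Obj C" and B: "B \<in> Obj C" using HomsD[OF h] HomsD[OF f] by simp_all
    note fh = Comp_in_Homs[OF h f] and gh = Comp_in_Homs[OF h g] and nh = Comp_in_Homs[OF h n]
    interpret G: comm_group "Hom_group C T B" by (rule Hom_comm_group[OF T B])
    have "g \<cdot> h \<boxplus> n \<cdot> h = n \<cdot> h \<boxplus> g \<cdot> h"
      using G.m_comm[of "g \<cdot> h" "n \<cdot> h"] gh nh by (simp add: Hom_group_def)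
    also have "\<dots> = Zero C T B"
      using Comp_Add_left[OF h n g] ng Comp_Zero_left[OF B h] by simp
    finally have "(f \<boxplus> n) \<cdot> h = Zero C T B \<longleftrightarrow> f \<cdot> h \<boxplus> n \<cdot> h = g \<cdot> h \<boxplus> n \<cdot> h"
      using Comp_Add_left[OF h f n] by simp
    also have "\<dots> \<longleftrightarrow> f \<cdot> h = g \<cdot> h" by (rule Add_cancel_right[OF fh gh nh])
    finally show ?thesis .
  qed
  then show ?thesis using Add_in_Homs[OF f n] by blast
qed

section \<open>Pullback squares\<close>

lemma pullback_monomorphism:
  assumes f: "monomorphism C f" and sq: "pullback_square C f d f' d'"
  shows "monomorphism C f'"
proof -
  define A where "A = Dom C f"
  define B where "B = Cod C f"
  define Z where "Z = Dom C d"
  define P where "P = Dom C f'"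
  have fh: "f \<in> Homs C A B" and dh: "d \<in> Homs C Z B" and fh': "f' \<in> Homs C P Z"
    and dh': "d' \<in> Homs C P A" and comm: "d \<cdot> f' = f \<cdot> d'"
    using sq unfolding pullback_square_def Homs_def A_def B_def Z_def P_def by simp_all
  show ?thesis
  proof (rule monomorphismI[OF fh'])
    fix T s t assume s: "s \<in> Homs C T P" and t: "t \<in> Homs C T P" and eq: "f' \<cdot> s = f' \<cdot> t"
    have df: "d \<cdot> (f' \<cdot> v) = f \<cdot> (d' \<cdot> v)" if "v \<in> Homs C T P" for v
      using Comp_assoc[OF that fh' dh] Comp_assoc[OF that dh' fh] comm by simp
    have "f \<cdot> (d' \<cdot> s) = f \<cdot> (d' \<cdot> t)" using df[OF s] df[OF t] eq by simp
    then have eq': "d' \<cdot> s = d' \<cdot> t"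
      using monomorphismD[OF f fh Comp_in_Homs[OF s dh'] Comp_in_Homs[OF t dh']] by simp
    have "\<exists>!u. u \<in> Homs C T P \<and> f' \<cdot> u = f' \<cdot> s \<and> d' \<cdot> u = d' \<cdot> s"
      using sq Comp_in_Homs[OF s fh'] Comp_in_Homs[OF s dh'] df[OF s]
      unfolding pullback_square_def A_def B_def Z_def P_def by blast
    then show "s = t" using s t eq eq' by auto
  qed
qed

lemma biproduct_pairing:
  assumes "biproduct C A Z S i j p q" and s: "s \<in> Homs C T A" and t: "t \<in> Homs C T Z"
  shows "i \<cdot> s \<boxplus> j \<cdot> t \<in> Homs C T S"
    and "p \<cdot> (i \<cdot> s \<boxplus> j \<cdot> t) = s" and "q \<cdot> (i \<cdot> s \<boxplus> j \<cdot> t) = t"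
proof -
  have i: "i \<in> Homs C A S" and j: "j \<in> Homs C Z S" and p: "p \<in> Homs C S A" and q: "q \<in> Homs C S Z"
    and eqs: "p \<cdot> i = Ident C A" "q \<cdot> j = Ident C Z" "p \<cdot> j = Zero C Z A" "q \<cdot> i = Zero C A Z"
    using assms(1) by (auto simp: biproduct_def)
  have A: "A \<in> Obj C" and Z: "Z \<in> Obj C" using HomsD[OF s] HomsD[OF t] by simp_all
  note ias = Comp_in_Homs[OF s i] and jt = Comp_in_Homs[OF t j]
  show "i \<cdot> s \<boxplus> j \<cdot> t \<in> Homs C T S" by (rule Add_in_Homs[OF ias jt])
  show "p \<cdot> (i \<cdot> s \<boxplus> j \<cdot> t) = s"
    using Comp_Add_right[OF ias jt p] Comp_assoc[OF s i p] Comp_assoc[OF t j p] eqs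
      Comp_Ident_left[OF s] Comp_Zero_left[OF A t] Add_Zero_right[OF s] by simp
  show "q \<cdot> (i \<cdot> s \<boxplus> j \<cdot> t) = t"
    using Comp_Add_right[OF ias jt q] Comp_assoc[OF s i q] Comp_assoc[OF t j q] eqs
      Comp_Ident_left[OF t] Comp_Zero_left[OF Z s] Add_Zero_left[OF t] by simp
qed

lemma biproduct_joint_mono:
  assumes "biproduct C A Z S i j p q" and x: "x \<in> Homs C T S" and y: "y \<in> Homs C T S"
    and "p \<cdot> x = p \<cdot> y" "q \<cdot> x = q \<cdot> y"
  shows "x = y"
proof -
  have i: "i \<in> Homs C A S" and j: "j \<in> Homs C Z S" and p: "p \<in> Homs C S A" and q: "q \<in> Homs C S Z"
    and sp: "i \<cdot> p \<boxplus> j \<cdot> q = Ident C S"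
    using assms(1) by (auto simp: biproduct_def)
  have "h = i \<cdot> (p \<cdot> h) \<boxplus> j \<cdot> (q \<cdot> h)" if h: "h \<in> Homs C T S" for h
    using Comp_Add_left[OF h Comp_in_Homs[OF p i] Comp_in_Homs[OF q j]]
      Comp_assoc[OF h p i] Comp_assoc[OF h q j] sp Comp_Ident_left[OF h] by simp
  from this[OF x] this[OF y] show ?thesis using assms(4,5) by simp
qed

text \<open>
  A pullback of \<open>f\<close> and \<open>d\<close> is the equalizer of \<open>f \<cdot> p\<close> and \<open>d \<cdot> q\<close> on the biproduct, and in the
  additive setting an equalizer is the kernel of a difference.
\<close>

lemma pullback_pair_is_kernel:
  assumes sq: "pullback_square C f d f' d'"
    and bip: "biproduct C (Dom C f) (Dom C d) S i j p q"
  shows "is_kernel C (i \<cdot> d' \<boxplus> j \<cdot> f')"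
proof -
  define A where "A = Dom C f"
  define B where "B = Cod C f"
  define Z where "Z = Dom C d"
  define P where "P = Dom C f'"
  have fh: "f \<in> Homs C A B" and dh: "d \<in> Homs C Z B" and fh': "f' \<in> Homs C P Z"
    and dh': "d' \<in> Homs C P A" and comm: "d \<cdot> f' = f \<cdot> d'"
    using sq unfolding pullback_square_def Homs_def A_def B_def Z_def P_def by simp_all
  have univ: "\<exists>!u. u \<in> Homs C T P \<and> f' \<cdot> u = s \<and> d' \<cdot> u = t"
    if "s \<in> Homs C T Z" "t \<in> Homs C T A" "d \<cdot> s = f \<cdot> t" for T s t
    using sq that unfolding pullback_square_def A_def Z_def P_def by blast
  have bip': "biproduct C A Z S i j p q" using bip by (simp add: A_def Z_def)
  then have p: "p \<in> Homs C S A" and q: "q \<in> Homs C S Z" by (auto simp: biproduct_def)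
  define k where "k = i \<cdot> d' \<boxplus> j \<cdot> f'"
  have k: "k \<in> Homs C P S" and pk: "p \<cdot> k = d'" and qk: "q \<cdot> k = f'"
    using biproduct_pairing[OF bip' dh' fh'] by (simp_all add: k_def)
  obtain w where w: "w \<in> Homs C S B" and
    w0: "\<And>T h. h \<in> Homs C T S \<Longrightarrow> w \<cdot> h = Zero C T B \<longleftrightarrow> (f \<cdot> p) \<cdot> h = (d \<cdot> q) \<cdot> h"
    using ex_difference[OF Comp_in_Homs[OF p fh] Comp_in_Homs[OF q dh]] by blast
  have key: "w \<cdot> h = Zero C T B \<longleftrightarrow> d \<cdot> (q \<cdot> h) = f \<cdot> (p \<cdot> h)" if h: "h \<in> Homs C T S" for T h
    using w0[OF h] Comp_assoc[OF h p fh] Comp_assoc[OF h q dh] by auto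
  have wk: "w \<cdot> k = Zero C P B" using key[OF k] pk qk comm by simp
  have ku: "\<exists>!u. u \<in> Homs C T P \<and> k \<cdot> u = h"
    if h: "h \<in> Homs C T S" and wh: "w \<cdot> h = Zero C T B" for T h
  proof -
    have "k \<cdot> u = h \<longleftrightarrow> f' \<cdot> u = q \<cdot> h \<and> d' \<cdot> u = p \<cdot> h" if u: "u \<in> Homs C T P" for u
      using biproduct_joint_mono[OF bip' Comp_in_Homs[OF u k] h]
        Comp_assoc[OF u k p] Comp_assoc[OF u k q] pk qk by auto
    then have "(u \<in> Homs C T P \<and> k \<cdot> u = h) = (u \<in> Homs C T P \<and> f' \<cdot> u = q \<cdot> h \<and> d' \<cdot> u = p \<cdot> h)" for u
      by blast
    then show ?thesis
      using univ[OF Comp_in_Homs[OF h q] Comp_in_Homs[OF h p]] key[OF h] wh by simp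
  qed
  have "kernel_of C w k"
    unfolding kernel_of_def
  proof (intro conjI ballI impI)
    fix h assume "h \<in> Arr C" and h: "Cod C h = Dom C w \<and> w \<cdot> h = Zero C (Dom C h) (Cod C w)"
    then have "h \<in> Homs C (Dom C h) S" using HomsD[OF w] by (simp add: Homs_def)
    then show "\<exists>!u. u \<in> Homs C (Dom C h) (Dom C k) \<and> k \<cdot> u = h"
      using ku[of h "Dom C h"] h HomsD[OF w] HomsD[OF k] by simp
  qed (use wk HomsD[OF w] HomsD[OF k] in simp_all)
  then show ?thesis unfolding is_kernel_def k_def by blast
qed

end

section \<open>Universal monomorphisms under pullback\<close>

context quasi_abelian_category
begin

lemma pullback_universal_mono:
  assumes uf: "universal_mono C f" and sq: "pullback_square C f d f' d'"
  shows "universal_mono C f'"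
  unfolding universal_mono_def
proof (intro conjI allI impI)
  show "monomorphism C f'" using pullback_monomorphism[OF _ sq] uf by (simp add: universal_mono_def)
next
  fix g f'' g'' assume po: "pushout_square C f' g f'' g''"
  define A where "A = Dom C f"
  define B where "B = Cod C f"
  define Z where "Z = Dom C d"
  define P where "P = Dom C f'"
  define X where "X = Cod C g"
  define R where "R = Cod C f''"
  have fh: "f \<in> Homs C A B" and dh: "d \<in> Homs C Z B" and fh': "f' \<in> Homs C P Z"
    and dh': "d' \<in> Homs C P A" and comm: "d \<cdot> f' = f \<cdot> d'"
    using sq unfolding pullback_square_def Homs_def A_def B_def Z_def P_def by simp_all
  have codf': "Cod C f' = Z" using HomsD[OF fh'] by simp
  have gh: "g \<in> Homs C P X" and fh'': "f'' \<in> Homs C X R"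
    using po unfolding pushout_square_def Homs_def P_def X_def R_def by simp_all
  have univ: "\<exists>!u. u \<in> Homs C R T \<and> u \<cdot> f'' = s \<and> u \<cdot> g'' = t"
    if "s \<in> Homs C X T" "t \<in> Homs C Z T" "s \<cdot> g = t \<cdot> f'" for T s t
    using po that codf' unfolding pushout_square_def X_def R_def by blast
  have "A \<in> Obj C" "Z \<in> Obj C" using HomsD[OF fh] HomsD[OF dh] by simp_all
  then obtain S i j p q where bip: "biproduct C A Z S i j p q" using ex_biproduct by blast
  then have i: "i \<in> Homs C A S" and j: "j \<in> Homs C Z S" by (auto simp: biproduct_def)
  define k where "k = i \<cdot> d' \<boxplus> j \<cdot> f'"
  have k: "k \<in> Homs C P S" unfolding k_def by (rule biproduct_pairing(1)[OF bip dh' fh'])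
  have ker: "is_kernel C k"
    unfolding k_def using pullback_pair_is_kernel[OF sq] bip by (simp add: A_def Z_def)
  obtain k' g' where po1: "pushout_square C k g k' g'" using ex_pushout_square[OF k gh] by blast
  have mk': "monomorphism C k'"
    using kernels_stable ker po1 kernel_is_monomorphism unfolding stable_under_pushout_def by blast
  define Y where "Y = Cod C k'"
  have kh': "k' \<in> Homs C X Y" and gh': "g' \<in> Homs C S Y" and comm1: "k' \<cdot> g = g' \<cdot> k"
    using po1 HomsD[OF k] unfolding pushout_square_def Homs_def X_def Y_def by simp_all
  define a where "a = g' \<cdot> i"
  define b where "b = g' \<cdot> j"
  have a: "a \<in> Homs C A Y" and b: "b \<in> Homs C Z Y"
    unfolding a_def b_def by (rule Comp_in_Homs[OF i gh'], rule Comp_in_Homs[OF j gh'])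
  have kg: "k' \<cdot> g = a \<cdot> d' \<boxplus> b \<cdot> f'"
    unfolding comm1 k_def a_def b_def
    using Comp_Add_right[OF Comp_in_Homs[OF dh' i] Comp_in_Homs[OF fh' j] gh']
      Comp_assoc[OF dh' i gh'] Comp_assoc[OF fh' j gh'] by simp
  obtain F a' where po2: "pushout_square C f a F a'" using ex_pushout_square[OF fh a] by blast
  have mF: "monomorphism C F" using uf po2 unfolding universal_mono_def by blast
  define Q where "Q = Cod C F"
  have F: "F \<in> Homs C Y Q" and a': "a' \<in> Homs C B Q" and comm2: "F \<cdot> a = a' \<cdot> f"
    using po2 HomsD[OF a] unfolding pushout_square_def Homs_def B_def Q_def by simp_all
  \<comment> \<open>The arrow from \<open>Z\<close> that matches \<open>F \<cdot> k'\<close>: on the \<open>A\<close>-summand \<open>F\<close> may be traded for \<open>a'\<close>,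
      which turns \<open>f \<cdot> d'\<close> into \<open>d \<cdot> f'\<close>.\<close>
  define t where "t = a' \<cdot> d \<boxplus> F \<cdot> b"
  note a'd = Comp_in_Homs[OF dh a'] and Fb = Comp_in_Homs[OF b F]
  have t: "t \<in> Homs C Z Q" unfolding t_def by (rule Add_in_Homs[OF a'd Fb])
  have "(F \<cdot> k') \<cdot> g = F \<cdot> (a \<cdot> d' \<boxplus> b \<cdot> f')" using Comp_assoc[OF gh kh' F] kg by simp
  also have "\<dots> = F \<cdot> (a \<cdot> d') \<boxplus> F \<cdot> (b \<cdot> f')"
    by (rule Comp_Add_right[OF Comp_in_Homs[OF dh' a] Comp_in_Homs[OF fh' b] F])
  also have "F \<cdot> (a \<cdot> d') = a' \<cdot> (f \<cdot> d')"
    using Comp_assoc[OF dh' a F] Comp_assoc[OF dh' fh a'] comm2 by simp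
  also have "\<dots> = (a' \<cdot> d) \<cdot> f'" using Comp_assoc[OF fh' dh a'] comm by simp
  also have "F \<cdot> (b \<cdot> f') = (F \<cdot> b) \<cdot> f'" using Comp_assoc[OF fh' b F] by simp
  also have "(a' \<cdot> d) \<cdot> f' \<boxplus> (F \<cdot> b) \<cdot> f' = t \<cdot> f'"
    unfolding t_def by (rule Comp_Add_left[OF fh' a'd Fb, symmetric])
  finally obtain u where u: "u \<in> Homs C R Q" and uf'': "u \<cdot> f'' = F \<cdot> k'"
    using univ[OF Comp_in_Homs[OF kh' F] t] by blast
  have "monomorphism C (u \<cdot> f'')" unfolding uf'' by (rule monomorphism_Comp[OF kh' F mk' mF])
  then show "monomorphism C f''" by (rule monomorphism_first_factor[OF fh'' u])
qed

end

section \<open>Duality\<close>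

text \<open>
  A record update rather than a new record, so that the opposite lives in the same type as \<open>C\<close>
  and the scheme extension is carried along.
\<close>

definition opposite :: "('o, 'm, 'x) cat_scheme \<Rightarrow> ('o, 'm, 'x) cat_scheme" where
  "opposite C = C\<lparr>Dom := Cod C, Cod := Dom C, Comp := (\<lambda>g f. Comp C f g),
     Zero := (\<lambda>A B. Zero C B A)\<rparr>"

lemma opposite_simps [simp]:
  "Obj (opposite C) = Obj C" "Arr (opposite C) = Arr C"
  "Dom (opposite C) = Cod C" "Cod (opposite C) = Dom C"
  "Ident (opposite C) = Ident C" "Comp (opposite C) g f = Comp C f g"
  "Add (opposite C) = Add C" "Zero (opposite C) A B = Zero C B A"
  by (simp_all add: opposite_def)

lemma Homs_opposite [simp]: "Homs (opposite C) A B = Homs C B A"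
  by (auto simp: Homs_def)

lemma Hom_group_opposite [simp]: "Hom_group (opposite C) A B = Hom_group C B A"
  by (simp add: Hom_group_def)

lemma zero_object_opposite [simp]: "zero_object (opposite C) = zero_object C"
  by (intro ext) (simp only: zero_object_def opposite_simps Homs_opposite conj_commute)

lemma biproduct_opposite:
  "biproduct (opposite C) A B S p q i j \<longleftrightarrow> biproduct C A B S i j p q"
  by (auto simp: biproduct_def)

lemma kernel_of_opposite [simp]: "kernel_of (opposite C) = cokernel_of C"
  by (intro ext) (simp only: kernel_of_def cokernel_of_def opposite_simps Homs_opposite)

lemma cokernel_of_opposite [simp]: "cokernel_of (opposite C) = kernel_of C"
  by (intro ext) (simp only: kernel_of_def cokernel_of_def opposite_simps Homs_opposite)

lemma is_kernel_opposite [simp]: "is_kernel (opposite C) = is_cokernel C"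
  by (intro ext) (simp only: is_kernel_def is_cokernel_def kernel_of_opposite cokernel_of_opposite)

lemma is_cokernel_opposite [simp]: "is_cokernel (opposite C) = is_kernel C"
  by (intro ext) (simp only: is_kernel_def is_cokernel_def kernel_of_opposite cokernel_of_opposite)

lemma pushout_square_opposite [simp]: "pushout_square (opposite C) = pullback_square C"
  by (intro ext) (simp only: pushout_square_def pullback_square_def opposite_simps Homs_opposite)

lemma pullback_square_opposite [simp]: "pullback_square (opposite C) = pushout_square C"
  by (intro ext) (simp only: pushout_square_def pullback_square_def opposite_simps Homs_opposite)

lemma universal_mono_opposite: "universal_mono (opposite C) = universal_epi C"
  by (intro ext) (simp only: universal_mono_def universal_epi_def monomorphism_def epimorphism_def
      pushout_square_opposite opposite_simps Homs_opposite)

lemma stable_under_pushout_opposite [simp]: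
  "stable_under_pushout (opposite C) = stable_under_pullback C"
  by (intro ext) (simp only: stable_under_pushout_def stable_under_pullback_def
      pushout_square_opposite pullback_square_opposite)

lemma stable_under_pullback_opposite [simp]:
  "stable_under_pullback (opposite C) = stable_under_pushout C"
  by (intro ext) (simp only: stable_under_pushout_def stable_under_pullback_def
      pushout_square_opposite pullback_square_opposite)

lemma quasi_abelian_opposite:
  assumes "quasi_abelian_category C"
  shows "quasi_abelian_category (opposite C)"
proof -
  interpret quasi_abelian_category C by (rule assms)
  show ?thesis
  proof (intro quasi_abelian_category.intro quasi_abelian_category_axioms.intro
      preabelian_category.intro preabelian_category_axioms.intro
      additive_category.intro additive_category_axioms.intro
      preadditive_category.intro preadditive_category_axioms.intro category.intro,
      unfold opposite_simps Homs_opposite Hom_group_opposite zero_object_opposite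
      kernel_of_opposite cokernel_of_opposite is_kernel_opposite is_cokernel_opposite
      stable_under_pushout_opposite stable_under_pullback_opposite)
    fix A B D E f g h assume "f \<in> Homs C B A" "g \<in> Homs C D B" "h \<in> Homs C E D"
    then show "f \<cdot>\<^bsub>C\<^esub> (g \<cdot>\<^bsub>C\<^esub> h) = (f \<cdot>\<^bsub>C\<^esub> g) \<cdot>\<^bsub>C\<^esub> h" by (simp add: Comp_assoc[of h E D g B f A])
  next
    fix A B assume "A \<in> Obj C" "B \<in> Obj C"
    then show "\<exists>S i j p q. biproduct (opposite C) A B S i j p q"
      using ex_biproduct[of A B] biproduct_opposite by metis
  qed (rule Dom_in_Obj Cod_in_Obj Ident_in_Homs Comp_in_Homs Comp_Ident_left Comp_Ident_right
      Hom_comm_group Comp_Add_left Comp_Add_right ex_zero_object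
      ex_kernel ex_cokernel kernels_stable cokernels_stable; assumption)+
qed

theorem theorem4p1:
  fixes C :: "('o, 'm, 'x) cat_scheme"
  assumes "quasi_abelian_category C"
  shows "(\<forall>f d f' d'. universal_mono C f \<and> pullback_square C f d f' d' \<longrightarrow> universal_mono C f') \<and>
         (\<forall>f g f' g'. universal_epi C f \<and> pushout_square C f g f' g' \<longrightarrow> universal_epi C f')"
  using quasi_abelian_category.pullback_universal_mono[OF assms]
    quasi_abelian_category.pullback_universal_mono[OF quasi_abelian_opposite[OF assms]]
  unfolding universal_mono_opposite pullback_square_opposite by blast

end
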